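(* Let $G$ be a simple graph on $n$ vertices with degree sequence $\Delta=d_{1}\geq d_{2}\geq \cdots \geq d_{n}=\delta$, where $\Delta\geq 2$. Define $s:=d_1+\cdots+d_{\Delta}-\Delta$. Then: (i) $dis_{\ell}[G] \leq s+1 \leq \Delta^2-\Delta+1$. (ii) $dis_{\ell}[G]\leq m$, where $m$ is the number of edges of $G$. (iii) If there are exactly $t$ vertices of degree $\Delta$ in $G$, then $dis_{\ell}[G] \leq \min\{\Delta^{2}-2\Delta +t +1,\ \Delta^2-\Delta+1\}$. (iv) If there is a unique vertex of degree $\Delta$ in $G$, then $dis_{\ell}[G] \leq \Delta^2-3\Delta+4$. (v) If $G$ is a strongly regular graph with parameters $(n,k,\lambda,\mu)$, then $dis_{\ell}[G] \leq k(k-\lambda-1) +1$. (vi) $dis_{\ell}[G] \leq \left(\dfrac{n-1}{2}\right)^{2}+1$.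
   Context: All graphs are finite, undirected, without loops or multiple edges. Natural numbers are positive integers. $\Delta$ and $\delta$ denote the maximum and minimum degree of $G$. For a vertex $v$ of a graph $G$, $N[v]$ denotes the closed neighborhood of $v$ (i.e. $v$ together with its neighbors). A labeling $f$ of $V(G)$ by numbers is closed distinguishing if for any two adjacent vertices $u,v$ with $N[u]\neq N[v]$ we have $\sum_{w\in N[u]} f(w)\neq \sum_{w\in N[v]} f(w)$. The graph $G$ is closed distinguishing $k$-choosable if for every assignment of lists $L(v)$ of $k$ natural numbers to the vertices $v$ of $G$, there is a closed distinguishing labeling $f$ of $G$ with $f(v)\in L(v)$ for each $v\in V(G)$. The closed distinguishing choice number $dis_{\ell}[G]$ is the minimum natural number $k$ such that $G$ is closed distinguishing $k$-choosable. A $k$-regular graph on $n$ vertices is strongly regular with parameters $(n,k,\lambda,\mu)$ if every two adjacent vertices have exactly $\lambda$ common neighbors and every two distinct non-adjacent vertices have exactly $\mu$ common neighbors. *)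

theory Defs
  imports Complex_Main
begin

definition fin_simple_graph :: "'a set \<Rightarrow> 'a set set \<Rightarrow> bool" where
  "fin_simple_graph V E \<longleftrightarrow> finite V \<and> (\<forall>e\<in>E. e \<subseteq> V \<and> card e = 2)"

definition neighborhood :: "'a set \<Rightarrow> 'a set set \<Rightarrow> 'a \<Rightarrow> 'a set" where
  "neighborhood V E v = {u \<in> V. {v, u} \<in> E}"

definition closed_neighborhood :: "'a set \<Rightarrow> 'a set set \<Rightarrow> 'a \<Rightarrow> 'a set" where
  "closed_neighborhood V E v = insert v (neighborhood V E v)"

definition vertex_degree :: "'a set \<Rightarrow> 'a set set \<Rightarrow> 'a \<Rightarrow> nat" where
  "vertex_degree V E v = card (neighborhood V E v)"

(* Max is unspecified on the empty set, so this is meaningful only for nonempty V. *)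
definition max_degree :: "'a set \<Rightarrow> 'a set set \<Rightarrow> nat" where
  "max_degree V E = Max (vertex_degree V E ` V)"

(* Indices run from 1 to card V; the values of d elsewhere are irrelevant. *)
definition degree_sequence :: "'a set \<Rightarrow> 'a set set \<Rightarrow> (nat \<Rightarrow> nat) \<Rightarrow> bool" where
  "degree_sequence V E d \<longleftrightarrow>
     (\<exists>v. bij_betw v {1..card V} V \<and> (\<forall>i\<in>{1..card V}. d i = vertex_degree V E (v i))) \<and>
     (\<forall>i\<in>{1..card V}. \<forall>j\<in>{1..card V}. i \<le> j \<longrightarrow> d j \<le> d i)"

definition closed_distinguishing :: "'a set \<Rightarrow> 'a set set \<Rightarrow> ('a \<Rightarrow> nat) \<Rightarrow> bool" where
  "closed_distinguishing V E f \<longleftrightarrow>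
     (\<forall>u\<in>V. \<forall>v\<in>V. {u, v} \<in> E \<and> closed_neighborhood V E u \<noteq> closed_neighborhood V E v \<longrightarrow>
        (\<Sum>w\<in>closed_neighborhood V E u. f w) \<noteq> (\<Sum>w\<in>closed_neighborhood V E v. f w))"

(* Labels are positive: 0 is not allowed in a list. *)
definition closed_distinguishing_choosable :: "'a set \<Rightarrow> 'a set set \<Rightarrow> nat \<Rightarrow> bool" where
  "closed_distinguishing_choosable V E k \<longleftrightarrow>
     (\<forall>L :: 'a \<Rightarrow> nat set. (\<forall>v\<in>V. finite (L v) \<and> card (L v) = k \<and> 0 \<notin> L v) \<longrightarrow>
        (\<exists>f. closed_distinguishing V E f \<and> (\<forall>v\<in>V. f v \<in> L v)))"

(* LEAST is unspecified if no k qualifies, so an upper bound on this number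
   also requires choosability for some positive k. *)
definition closed_distinguishing_choice_number :: "'a set \<Rightarrow> 'a set set \<Rightarrow> nat" where
  "closed_distinguishing_choice_number V E =
     (LEAST k. 1 \<le> k \<and> closed_distinguishing_choosable V E k)"

definition strongly_regular :: "'a set \<Rightarrow> 'a set set \<Rightarrow> nat \<Rightarrow> nat \<Rightarrow> nat \<Rightarrow> nat \<Rightarrow> bool" where
  "strongly_regular V E n k l \<mu> \<longleftrightarrow>
     card V = n \<and> (\<forall>v\<in>V. vertex_degree V E v = k) \<and>
     (\<forall>u\<in>V. \<forall>v\<in>V. {u, v} \<in> E \<longrightarrow>
        card (neighborhood V E u \<inter> neighborhood V E v) = l) \<and>
     (\<forall>u\<in>V. \<forall>v\<in>V. u \<noteq> v \<and> {u, v} \<notin> E \<longrightarrow>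
        card (neighborhood V E u \<inter> neighborhood V E v) = \<mu>)"

end

theory Submission
  imports Defs
begin

text \<open>
  Label the vertices one after another. The constraint of an edge \<open>uv\<close> only involves the labels on the
  symmetric difference of \<open>N[u]\<close> and \<open>N[v]\<close>, so it forbids at most one value, namely for the last
  vertex \<open>w\<close> of that symmetric difference. Hence at most as many values are forbidden for \<open>w\<close> as there
  are edges joining \<open>N(w)\<close> to the complement of \<open>N[w]\<close>, and lists with one more element suffice. The
  vertex labelled first costs nothing: if the symmetric difference is a single vertex, the constraint
  says that its label is nonzero. For (iv) the vertex of maximum degree is labelled first.
\<close>

section \<open>Finite sums and greedy choice of labels\<close>

lemma sum_eq_iff_sum_Diff_eq:
  fixes f :: "'a \<Rightarrow> nat"
  assumes "finite A" "finite B"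
  shows "sum f A = sum f B \<longleftrightarrow> sum f (A - B) = sum f (B - A)"
proof -
  have "sum f A = sum f (A \<inter> B) + sum f (A - B)"
    using sum.Int_Diff[OF assms(1)] .
  moreover have "sum f B = sum f (A \<inter> B) + sum f (B - A)"
    using sum.Int_Diff[OF assms(2), of f A] by (simp add: Int_commute)
  ultimately show ?thesis
    by simp
qed

text \<open>Induction on the set of labelled vertices, with \<open>v0\<close> labelled from the
  start. Since \<open>C\<close> is symmetric, counting the pairs with \<open>v\<close> in
  \<open>A - B\<close> also accounts for those with \<open>v\<close> in \<open>B - A\<close>: each
  unordered constraint is counted once at \<open>v\<close>. For \<open>v0\<close> any nonempty list
  without 0 will do.\<close>

lemma greedy_labeling:
  fixes L :: "'a \<Rightarrow> nat set"
  assumes V: "finite V" and C: "finite C" "sym C"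
    and sub: "\<And>A B. (A, B) \<in> C \<Longrightarrow> A \<subseteq> V"
    and neq: "\<And>A B. (A, B) \<in> C \<Longrightarrow> A \<noteq> B"
    and first: "L v0 \<noteq> {}" "0 \<notin> L v0"
    and lists: "\<And>v. v \<in> V - {v0} \<Longrightarrow> card {(A, B). (A, B) \<in> C \<and> v \<in> A - B} < card (L v)"
  shows "\<exists>f. (\<forall>v\<in>V. f v \<in> L v) \<and> (\<forall>(A, B)\<in>C. sum f A \<noteq> sum f B)"
proof -
  have sub2: "B \<subseteq> V" if "(A, B) \<in> C" for A B
    using sub symD[OF C(2) that] by blast
  have fin: "finite A" "finite B" if "(A, B) \<in> C" for A B
    using sub[OF that] sub2[OF that] V finite_subset by auto
  have ne: "L v \<noteq> {}" if "v \<in> V" for v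
    using lists[of v] that first(1) by fastforce
  \<comment> \<open>The labeling is total from the start. Labels outside \<open>insert v0 U\<close>
    are provisional, so the invariant speaks only of pairs whose symmetric difference is already
    labelled.\<close>
  have "\<exists>f. (\<forall>v\<in>insert v0 V. f v \<in> L v) \<and>
      (\<forall>(A, B)\<in>C. sym_diff A B \<subseteq> insert v0 U \<longrightarrow> sum f (A - B) \<noteq> sum f (B - A))"
    if "finite U" "U \<subseteq> V" for U
    using that
  proof (induction U)
    case empty
    define f where "f v = (SOME x. x \<in> L v)" for v
    have f: "f v \<in> L v" if "v \<in> insert v0 V" for v
      unfolding f_def using ne[of v] first(1) that by (auto simp: some_in_eq)
    have "sum f (A - B) \<noteq> sum f (B - A)" if AB: "(A, B) \<in> C" "sym_diff A B \<subseteq> {v0}" for A B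
    proof -
      have "f v0 \<noteq> 0"
        using f[of v0] first(2) by (metis insertI1)
      then have ne0: "sum f {v0} \<noteq> sum f {}"
        by simp
      \<comment> \<open>Distinct sets have a nonempty symmetric difference, here exactly
        \<open>{v0}\<close>; the two sums are then \<open>f v0\<close> and 0.\<close>
      consider "A - B = {v0}" "B - A = {}" | "A - B = {}" "B - A = {v0}"
        using neq[OF AB(1)] AB(2) by blast
      then show ?thesis
        by cases (use ne0 in metis)+
    qed
    with f show ?case
      by (intro exI[of _ f]) auto
  next
    case (insert w U)
    then obtain f where fL: "\<forall>v\<in>insert v0 V. f v \<in> L v"
      and fC': "\<forall>(A, B)\<in>C. sym_diff A B \<subseteq> insert v0 U \<longrightarrow> sum f (A - B) \<noteq> sum f (B - A)"
      by blast
    have fC: "sum f (A - B) \<noteq> sum f (B - A)" if "(A, B) \<in> C" "sym_diff A B \<subseteq> insert v0 U" for A B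
      using fC' that by blast
    show ?case
    proof (cases "w = v0")
      case True
      then have eq: "insert v0 (insert w U) = insert v0 U"
        by simp
      show ?thesis
        unfolding eq by (intro exI[of _ f] conjI fL fC')
    next
      case False
      define P where "P = {(A, B). (A, B) \<in> C \<and> w \<in> A - B}"
      \<comment> \<open>The labels of \<open>w\<close> that would violate some pair with
        \<open>w\<close> in \<open>A - B\<close>. If the difference is negative, no label violates
        the pair, and truncation to 0 merely excludes a harmless extra value.\<close>
      define F where "F = (\<lambda>(A, B). sum f (B - A) - sum f (A - B - {w})) ` P"
      have "finite P"
        by (rule finite_subset[OF _ C(1)]) (auto simp: P_def)
      then have "finite F" "card F \<le> card P"
        unfolding F_def by (auto intro: card_image_le)
      moreover have "card P < card (L w)"
        unfolding P_def using lists[of w] insert.prems False by auto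
      ultimately have "\<not> L w \<subseteq> F"
        using card_mono[of F "L w"] by linarith
      then obtain x where x: "x \<in> L w" "x \<notin> F"
        by blast
      define g where "g = f(w := x)"
      have new: "sum g (A - B) \<noteq> sum g (B - A)" if AB: "(A, B) \<in> C" "w \<in> A - B" for A B
      proof -
        have "sum g (A - B) = x + sum f (A - B - {w})"
          using fin[OF AB(1)] AB(2) by (subst sum.remove[of _ w]) (auto simp: g_def)
        moreover have "sum g (B - A) = sum f (B - A)"
          using AB(2) by (intro sum.cong) (auto simp: g_def)
        moreover have "sum f (B - A) - sum f (A - B - {w}) \<in> F"
          unfolding F_def by (rule rev_image_eqI[of "(A, B)"]) (use AB in \<open>auto simp: P_def\<close>)
        then have "x \<noteq> sum f (B - A) - sum f (A - B - {w})"
          using x(2) by blast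
        ultimately show ?thesis
          by linarith
      qed
      have gC: "sum g (A - B) \<noteq> sum g (B - A)"
        if AB: "(A, B) \<in> C" "sym_diff A B \<subseteq> insert v0 (insert w U)" for A B
      proof -
        consider "w \<in> A - B" | "w \<in> B - A" | "w \<notin> sym_diff A B"
          by blast
        then show ?thesis
        proof cases
          case 1
          with new AB(1) show ?thesis by blast
        next
          case 2
          \<comment> \<open>The reversed pair lies in \<open>C\<close> too and has \<open>w\<close>
            in its first difference.\<close>
          from new[OF symD[OF C(2) AB(1)] this] show ?thesis by (rule not_sym)
        next
          case 3
          then have "sum g (A - B) = sum f (A - B)" "sum g (B - A) = sum f (B - A)"
            by (auto simp: g_def intro!: sum.cong)
          then show ?thesis
            using fC[OF AB(1)] AB(2) 3 by auto
        qed
      qed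
      have gL: "\<forall>v\<in>insert v0 V. g v \<in> L v"
        using fL x(1) by (auto simp: g_def)
      show ?thesis
        by (intro exI[of _ g] conjI gL ballI, split prod.split, intro allI impI gC) simp_all
    qed
  qed
  from this[OF V order_refl] obtain f where fL: "\<forall>v\<in>insert v0 V. f v \<in> L v"
    and fC: "\<forall>(A, B)\<in>C. sym_diff A B \<subseteq> insert v0 V \<longrightarrow> sum f (A - B) \<noteq> sum f (B - A)"
    by blast
  have "sum f A \<noteq> sum f B" if "(A, B) \<in> C" for A B
  proof -
    have "sym_diff A B \<subseteq> insert v0 V"
      using sub[OF that] sub2[OF that] by blast
    with fC that have "sum f (A - B) \<noteq> sum f (B - A)"
      by blast
    then show ?thesis
      unfolding sum_eq_iff_sum_Diff_eq[OF fin[OF that]] .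
  qed
  with fL show ?thesis
    by blast
qed

text \<open>Exchange argument: each index of \<open>J\<close> beyond \<open>k\<close> contributes at
  most \<open>g k\<close>, each index up to \<open>k\<close> missing from \<open>J\<close>
  contributes at least \<open>g k\<close>, and there are at least as many of the latter.\<close>

lemma sum_le_sum_initial_segment:
  fixes g :: "nat \<Rightarrow> nat"
  assumes anti: "\<And>i j. \<lbrakk>i \<in> {1..n}; j \<in> {1..n}; i \<le> j\<rbrakk> \<Longrightarrow> g j \<le> g i"
    and J: "J \<subseteq> {1..n}" "card J \<le> k" and "k \<le> n"
  shows "sum g J \<le> sum g {1..k}"
proof (cases "k = 0")
  case True
  then show ?thesis
    using J finite_subset[OF J(1)] by auto
next
  case False
  have fJ: "finite J"
    using J(1) finite_subset by blast
  have "card (J \<inter> {1..k}) + card (J - {1..k}) = card J"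
    using fJ by (metis card_Int_Diff)
  moreover have "card (J \<inter> {1..k}) + card ({1..k} - J) = k"
    using card_Int_Diff[of "{1..k}" J] by (simp add: Int_commute)
  ultimately have card: "card (J - {1..k}) \<le> card ({1..k} - J)"
    using J(2) by linarith
  have "sum g (J - {1..k}) \<le> card (J - {1..k}) * g k"
    using J(1) False \<open>k \<le> n\<close>
    by (intro sum_bounded_above[where K = "g k", simplified] anti) (auto simp: subset_iff)
  also have "\<dots> \<le> card ({1..k} - J) * g k"
    using card by simp
  also have "\<dots> \<le> sum g ({1..k} - J)"
    using False \<open>k \<le> n\<close>
    by (intro sum_bounded_below[where K = "g k", simplified] anti) auto
  finally have "sum g (J \<inter> {1..k}) + sum g (J - {1..k}) \<le> sum g (J \<inter> {1..k}) + sum g ({1..k} - J)"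
    by simp
  then show ?thesis
    using sum.Int_Diff[OF fJ, of g "{1..k}"] sum.Int_Diff[of "{1..k}" g J]
    by (simp add: Int_commute)
qed

section \<open>Graphs and the edges leaving a neighborhood\<close>

locale simple_graph =
  fixes V :: "'a set" and E :: "'a set set"
  assumes simple: "fin_simple_graph V E"
begin

abbreviation "nbh \<equiv> neighborhood V E"
abbreviation "cnbh \<equiv> closed_neighborhood V E"
abbreviation "deg \<equiv> vertex_degree V E"

lemma finite_V: "finite V"
  using simple by (simp add: fin_simple_graph_def)

lemma finite_E: "finite E"
  using simple finite_subset[of E "Pow V"] by (auto simp: fin_simple_graph_def)

lemma nbh_subset: "nbh v \<subseteq> V"
  by (auto simp: neighborhood_def)

lemma finite_nbh: "finite (nbh v)"
  using nbh_subset finite_V finite_subset by blast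

lemma not_in_nbh: "v \<notin> nbh v"
  using simple by (fastforce simp: neighborhood_def fin_simple_graph_def)

lemma edge_iff_nbh: "{u, v} \<in> E \<longleftrightarrow> v \<in> nbh u"
  using simple by (auto simp: neighborhood_def fin_simple_graph_def)

lemma nbh_sym: "v \<in> nbh u \<longleftrightarrow> u \<in> nbh v"
  by (metis edge_iff_nbh insert_commute)

lemma deg_pos: "u \<in> nbh w \<Longrightarrow> 1 \<le> deg u"
  unfolding vertex_degree_def
  using nbh_sym finite_nbh by (metis One_nat_def Suc_leI card_gt_0_iff empty_iff)

lemma deg_le_max_degree: "v \<in> V \<Longrightarrow> deg v \<le> max_degree V E"
  unfolding max_degree_def using finite_V by auto

text \<open>The edges between N(w) and the complement of N[w], oriented outwards. For adjacent
  \<open>u\<close> and \<open>v\<close>, the pair \<open>(u, v)\<close> belongs here exactly when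
  \<open>w\<close> lies in N[u] but not in N[v].\<close>

definition boundary :: "'a \<Rightarrow> ('a \<times> 'a) set" where
  "boundary w = (SIGMA u:nbh w. nbh u - cnbh w)"

lemma finite_boundary: "finite (boundary w)"
  unfolding boundary_def using finite_nbh by blast

text \<open>Greedy labeling with \<open>v0\<close> first, so the size of \<open>boundary v0\<close>
  does not enter. All later bounds are estimates of \<open>card (boundary w)\<close> put into this
  lemma.\<close>

lemma choice_number_le_boundary:
  assumes "v0 \<in> V" and bound: "\<And>w. w \<in> V - {v0} \<Longrightarrow> card (boundary w) \<le> M"
  shows "closed_distinguishing_choice_number V E \<le> M + 1"
proof -
  have "closed_distinguishing_choosable V E (M + 1)"
    unfolding closed_distinguishing_choosable_def
  proof (intro allI impI)
    fix L :: "'a \<Rightarrow> nat set"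
    assume L: "\<forall>v\<in>V. finite (L v) \<and> card (L v) = M + 1 \<and> 0 \<notin> L v"
    \<comment> \<open>Constraints are pairs of closed neighborhoods, so edges with the same pair of
      neighborhoods give a single constraint.\<close>
    define C where "C = {(cnbh u, cnbh v) | u v. u \<in> V \<and> v \<in> nbh u \<and> cnbh u \<noteq> cnbh v}"
    have "\<exists>f. (\<forall>v\<in>V. f v \<in> L v) \<and> (\<forall>(A, B)\<in>C. sum f A \<noteq> sum f B)"
    proof (rule greedy_labeling[where ?v0.0 = v0])
      have "C \<subseteq> (\<lambda>(u, v). (cnbh u, cnbh v)) ` (V \<times> V)"
        using nbh_subset by (force simp: C_def)
      then show "finite C"
        using finite_V finite_subset by blast
      show "sym C"
        unfolding C_def sym_def using nbh_sym nbh_subset by blast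
      show "A \<subseteq> V" if "(A, B) \<in> C" for A B
        using that nbh_subset by (auto simp: C_def closed_neighborhood_def)
      show "A \<noteq> B" if "(A, B) \<in> C" for A B
        using that by (auto simp: C_def)
      show "L v0 \<noteq> {}" "0 \<notin> L v0"
        using L \<open>v0 \<in> V\<close> by force+
    next
      fix w assume w: "w \<in> V - {v0}"
      have "{(A, B). (A, B) \<in> C \<and> w \<in> A - B} \<subseteq> (\<lambda>(u, v). (cnbh u, cnbh v)) ` boundary w"
        (is "?P \<subseteq> _")
      proof clarify
        fix A B assume "(A, B) \<in> C" "w \<in> A" "w \<notin> B"
        then obtain u v where uv: "A = cnbh u" "B = cnbh v" "v \<in> nbh u"
          by (auto simp: C_def)
        \<comment> \<open>Here \<open>w\<close> differs from \<open>u\<close>, because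
          \<open>u\<close> is adjacent to \<open>v\<close> and hence lies in
          \<open>B\<close>.\<close>
        with \<open>w \<in> A\<close> \<open>w \<notin> B\<close> have "(u, v) \<in> boundary w"
          using nbh_sym by (auto simp: boundary_def closed_neighborhood_def)
        with uv show "(A, B) \<in> (\<lambda>(u, v). (cnbh u, cnbh v)) ` boundary w"
          by force
      qed
      then have "card ?P \<le> card (boundary w)"
        using finite_boundary surj_card_le by blast
      also have "\<dots> < card (L w)"
        using bound[OF w] L w by auto
      finally show "card ?P < card (L w)" .
    qed (rule finite_V)
    then obtain f where f: "\<forall>v\<in>V. f v \<in> L v" "\<forall>(A, B)\<in>C. sum f A \<noteq> sum f B"
      by blast
    have "closed_distinguishing V E f"
      unfolding closed_distinguishing_def
    proof (intro ballI impI)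
      fix u v assume "u \<in> V" "{u, v} \<in> E \<and> cnbh u \<noteq> cnbh v"
      then have "(cnbh u, cnbh v) \<in> C"
        unfolding C_def using edge_iff_nbh by blast
      with f(2) show "sum f (cnbh u) \<noteq> sum f (cnbh v)"
        by blast
    qed
    with f(1) show "\<exists>f. closed_distinguishing V E f \<and> (\<forall>v\<in>V. f v \<in> L v)"
      by blast
  qed
  then show ?thesis
    unfolding closed_distinguishing_choice_number_def by (intro Least_le) simp
qed

section \<open>Estimates for the number of boundary edges\<close>

lemma card_boundary: "card (boundary w) = (\<Sum>u\<in>nbh w. card (nbh u - cnbh w))"
  unfolding boundary_def using finite_nbh by (intro card_SigmaI) auto

text \<open>Among the neighbors of \<open>u\<close>, at least \<open>w\<close> itself does not
  count.\<close>

lemma card_boundary_le_sum_deg: "card (boundary w) \<le> (\<Sum>u\<in>nbh w. deg u - 1)"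
  unfolding card_boundary
proof (rule sum_mono)
  fix u assume "u \<in> nbh w"
  then have "nbh u - cnbh w \<subseteq> nbh u - {w}" "w \<in> nbh u"
    using nbh_sym by (auto simp: closed_neighborhood_def)
  then show "card (nbh u - cnbh w) \<le> deg u - 1"
    unfolding vertex_degree_def using finite_nbh
    by (metis card_Diff_singleton card_mono finite_Diff)
qed

text \<open>Forgetting the orientation is injective, as exactly one end of a boundary edge is in
  N(w). No boundary edge contains \<open>w\<close>, so an edge at \<open>w\<close> is missed; if
  \<open>w\<close> is isolated, the boundary is empty.\<close>

lemma card_boundary_less_edges:
  assumes "E \<noteq> {}"
  shows "card (boundary w) < card E"
proof (cases "nbh w = {}")
  case True
  then show ?thesis
    using assms finite_E by (simp add: boundary_def card_gt_0_iff)
next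
  case False
  then obtain x where x: "{w, x} \<in> E"
    using edge_iff_nbh by blast
  have "inj_on (\<lambda>(u, v). {u, v}) (boundary w)"
    by (auto simp: inj_on_def boundary_def closed_neighborhood_def doubleton_eq_iff)
  moreover have "(\<lambda>(u, v). {u, v}) ` boundary w \<subseteq> E - {{w, x}}"
    using edge_iff_nbh not_in_nbh
    by (auto simp: boundary_def closed_neighborhood_def doubleton_eq_iff)
  ultimately have "card (boundary w) \<le> card (E - {{w, x}})"
    using finite_E by (metis card_inj_on_le finite_Diff)
  also have "\<dots> < card E"
    using x finite_E by (intro card_Diff1_less)
  finally show ?thesis .
qed

text \<open>The boundary embeds into the product of N(w) and the complement of N[w], whose sizes
  \<open>a\<close> and \<open>b\<close> add up to one less than the number of vertices. Then 4ab is
  at most the square of a + b.\<close>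

lemma four_mult_card_boundary_le:
  assumes "w \<in> V"
  shows "4 * card (boundary w) \<le> (card V - 1)\<^sup>2"
proof -
  define a b where "a = deg w" and "b = card (V - cnbh w)"
  have "boundary w \<subseteq> nbh w \<times> (V - cnbh w)"
    unfolding boundary_def using nbh_subset by blast
  then have "card (boundary w) \<le> a * b"
    unfolding a_def b_def vertex_degree_def
    using finite_nbh finite_V by (metis card_cartesian_product card_mono finite_Diff finite_cartesian_product)
  moreover have "card V - 1 = a + b"
  proof -
    have "cnbh w \<subseteq> V" "finite (cnbh w)" "card (cnbh w) = a + 1"
      using assms nbh_subset finite_nbh not_in_nbh
      by (auto simp: closed_neighborhood_def a_def vertex_degree_def)
    then show ?thesis
      using finite_V card_mono[of V "cnbh w"] by (simp add: b_def card_Diff_subset)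
  qed
  moreover have "4 * (a * b) \<le> (a + b)\<^sup>2"
  proof -
    have "int ((a + b)\<^sup>2) - int (4 * (a * b)) = (int a - int b)\<^sup>2"
      by (simp add: power2_eq_square algebra_simps)
    then show ?thesis
      by (smt (verit) of_nat_le_iff zero_le_power2)
  qed
  ultimately show ?thesis
    by simp
qed

text \<open>Of the \<open>k\<close> neighbors of \<open>u\<close>, exactly \<open>w\<close> and the
  \<open>l\<close> common neighbors with \<open>w\<close> lie in N[w]. If \<open>k\<close> is 0,
  then \<open>l\<close> is arbitrary, but over the integers the product still vanishes.\<close>

lemma card_boundary_strongly_regular:
  assumes "strongly_regular V E n k l \<mu>" "w \<in> V"
  shows "int (card (boundary w)) = int k * (int k - int l - 1)"
proof -
  have "int (card (nbh u - cnbh w)) = int k - int l - 1" if u: "u \<in> nbh w" for u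
  proof -
    have uV: "u \<in> V"
      using u nbh_subset by blast
    then have k: "card (nbh u) = k"
      using assms by (auto simp: strongly_regular_def vertex_degree_def)
    have l: "card (nbh u \<inter> nbh w) = l"
      using assms uV u edge_iff_nbh nbh_sym unfolding strongly_regular_def by blast
    have "nbh u \<inter> cnbh w = insert w (nbh u \<inter> nbh w)"
      using u nbh_sym by (auto simp: closed_neighborhood_def)
    then have "card (nbh u \<inter> cnbh w) = l + 1"
      using l finite_nbh not_in_nbh by simp
    with k card_Int_Diff[OF finite_nbh, of u "cnbh w"] show ?thesis
      by simp
  qed
  moreover have "card (nbh w) = k"
    using assms by (auto simp: strongly_regular_def vertex_degree_def)
  ultimately show ?thesis
    by (simp add: card_boundary)
qed

text \<open>Every neighbor of \<open>w\<close> contributes at most the maximum degree minus 2, with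
  one more allowed for those of maximum degree.\<close>

lemma card_boundary_le_count_max_degree:
  assumes "2 \<le> max_degree V E"
  shows "card (boundary w)
    \<le> deg w * (max_degree V E - 2) + card {u \<in> nbh w. deg u = max_degree V E}"
proof -
  have "(\<Sum>u\<in>nbh w. deg u - 1)
    \<le> (\<Sum>u\<in>nbh w. (max_degree V E - 2) + (if deg u = max_degree V E then 1 else 0))"
    using nbh_subset assms by (intro sum_mono) (use deg_le_max_degree in fastforce)
  also have "\<dots> = deg w * (max_degree V E - 2) + card {u \<in> nbh w. deg u = max_degree V E}"
    using finite_nbh by (simp add: sum.distrib vertex_degree_def flip: sum.inter_filter)
  finally show ?thesis
    using card_boundary_le_sum_deg[of w] by linarith
qed

section \<open>Degree sequences\<close>

lemma max_degree_vertex: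
  assumes "V \<noteq> {}"
  obtains x where "x \<in> V" "deg x = max_degree V E"
  using Max_in[of "deg ` V"] assms finite_V unfolding max_degree_def by fastforce

text \<open>Keeps the indices up to the maximum degree inside the range where \<open>d\<close> is
  specified.\<close>

lemma max_degree_le_card:
  assumes "V \<noteq> {}"
  shows "max_degree V E \<le> card V"
  using max_degree_vertex[OF assms] card_mono[OF finite_V nbh_subset]
  unfolding vertex_degree_def by metis

text \<open>Positivity matters because \<open>d i - 1\<close> is truncated. A vertex of maximum
  degree has that many neighbors, all of positive degree; they cannot all occupy positions before
  \<open>i\<close>, so some position from \<open>i\<close> on carries a positive degree, and
  \<open>d\<close> is non-increasing.\<close>

lemma degree_sequence_bounds:
  assumes "V \<noteq> {}" and d: "degree_sequence V E d" and i: "i \<in> {1..max_degree V E}"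
  shows "1 \<le> d i" "d i \<le> max_degree V E"
proof -
  obtain p where p: "bij_betw p {1..card V} V" "\<And>i. i \<in> {1..card V} \<Longrightarrow> d i = deg (p i)"
    and anti: "\<And>i j. \<lbrakk>i \<in> {1..card V}; j \<in> {1..card V}; i \<le> j\<rbrakk> \<Longrightarrow> d j \<le> d i"
    using d unfolding degree_sequence_def by blast
  have iV: "i \<in> {1..card V}"
    using i max_degree_le_card[OF assms(1)] by auto
  then show "d i \<le> max_degree V E"
    using p deg_le_max_degree by (auto dest: bij_betwE)
  obtain x where x: "x \<in> V" "deg x = max_degree V E"
    using max_degree_vertex[OF assms(1)] .
  define J where "J = {j \<in> {1..card V}. p j \<in> nbh x}"
  have "p ` J = p ` {1..card V} \<inter> nbh x"
    by (auto simp: J_def)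
  then have "nbh x \<subseteq> p ` J"
    using bij_betw_imp_surj_on[OF p(1)] nbh_subset[of x] by auto
  then have "max_degree V E \<le> card J"
    using surj_card_le[of J "nbh x" p] x(2) by (simp add: J_def vertex_degree_def)
  moreover have "card {1..<i} < max_degree V E"
    using i by auto
  ultimately have "\<not> J \<subseteq> {1..<i}"
    using card_mono[of "{1..<i}" J] by auto
  then obtain j where "j \<in> J" "j \<notin> {1..<i}"
    by blast
  then have j: "j \<in> J" "i \<le> j"
    by (auto simp: J_def)
  then have "1 \<le> d j"
    using p(2) deg_pos by (auto simp: J_def)
  also have "d j \<le> d i"
    using j iV by (intro anti) (auto simp: J_def)
  finally show "1 \<le> d i" .
qed

text \<open>The neighbors of \<open>w\<close> occupy a set \<open>J\<close> of at most
  maximum-degree many positions, and in a non-increasing sequence the initial segment has the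
  largest sum.\<close>

lemma card_boundary_le_degree_sequence:
  assumes "V \<noteq> {}" and d: "degree_sequence V E d" and w: "w \<in> V"
  shows "card (boundary w) \<le> (\<Sum>i=1..max_degree V E. d i - 1)"
proof -
  obtain p where p: "bij_betw p {1..card V} V" "\<And>i. i \<in> {1..card V} \<Longrightarrow> d i = deg (p i)"
    and anti: "\<And>i j. \<lbrakk>i \<in> {1..card V}; j \<in> {1..card V}; i \<le> j\<rbrakk> \<Longrightarrow> d j \<le> d i"
    using d unfolding degree_sequence_def by blast
  define J where "J = {j \<in> {1..card V}. p j \<in> nbh w}"
  have "p ` J = p ` {1..card V} \<inter> nbh w"
    by (auto simp: J_def)
  then have "p ` J = nbh w"
    using bij_betw_imp_surj_on[OF p(1)] nbh_subset[of w] by auto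
  moreover have "inj_on p J"
    using bij_betw_imp_inj_on[OF p(1)] by (rule inj_on_subset) (auto simp: J_def)
  ultimately have bij: "bij_betw p J (nbh w)"
    by (simp add: bij_betw_def)
  have "(\<Sum>u\<in>nbh w. deg u - 1) = (\<Sum>j\<in>J. d j - 1)"
    unfolding sum.reindex_bij_betw[OF bij, symmetric]
    using p(2) by (intro sum.cong) (auto simp: J_def)
  also have "\<dots> \<le> (\<Sum>i=1..max_degree V E. d i - 1)"
  proof (rule sum_le_sum_initial_segment)
    show "card J \<le> max_degree V E"
      using bij_betw_same_card[OF bij] deg_le_max_degree[OF w] by (simp add: vertex_degree_def)
  qed (use anti max_degree_le_card[OF assms(1)] in \<open>auto simp: J_def diff_le_mono\<close>)
  finally show ?thesis
    using card_boundary_le_sum_deg[of w] by linarith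
qed

end

section \<open>Deduction of the six bounds\<close>

theorem theorem5:
  fixes V :: "'a set" and E :: "'a set set" and d :: "nat \<Rightarrow> nat"
    and n m \<Delta> :: nat and s :: int
  assumes "fin_simple_graph V E" and "V \<noteq> {}"
    and "n = card V" and "m = card E"
    and "\<Delta> = max_degree V E" and "2 \<le> \<Delta>"
    and "degree_sequence V E d"
    and "s = (\<Sum>i=1..\<Delta>. int (d i)) - int \<Delta>"
  shows "(int (closed_distinguishing_choice_number V E) \<le> s + 1 \<and>
          s + 1 \<le> (int \<Delta>)^2 - int \<Delta> + 1) \<and>
    closed_distinguishing_choice_number V E \<le> m \<and>
    (\<forall>t. card {v \<in> V. vertex_degree V E v = \<Delta>} = t \<longrightarrow>
       int (closed_distinguishing_choice_number V E)
         \<le> min ((int \<Delta>)^2 - 2 * int \<Delta> + int t + 1) ((int \<Delta>)^2 - int \<Delta> + 1)) \<and>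
    ((\<exists>!v. v \<in> V \<and> vertex_degree V E v = \<Delta>) \<longrightarrow>
       int (closed_distinguishing_choice_number V E) \<le> (int \<Delta>)^2 - 3 * int \<Delta> + 4) \<and>
    (\<forall>k l \<mu>. strongly_regular V E n k l \<mu> \<longrightarrow>
       int (closed_distinguishing_choice_number V E) \<le> int k * (int k - int l - 1) + 1) \<and>
    real (closed_distinguishing_choice_number V E) \<le> ((real n - 1) / 2)^2 + 1"
proof -
  interpret simple_graph V E
    using assms(1) by unfold_locales
  let ?c = "closed_distinguishing_choice_number V E"
  obtain x0 where x0: "x0 \<in> V"
    using assms(2) by blast
  \<comment> \<open>Integer form of the boundary criterion, suited to bounds that contain
    subtractions.\<close>
  have le: "int ?c \<le> M + 1"
    if "v0 \<in> V" "\<And>w. w \<in> V - {v0} \<Longrightarrow> int (card (boundary w)) \<le> M" "0 \<le> M" for v0 M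
  proof -
    have "?c \<le> nat M + 1"
      using that by (intro choice_number_le_boundary[of v0]) (force simp: le_nat_iff)+
    then show ?thesis
      using \<open>0 \<le> M\<close> by linarith
  qed
  note d = degree_sequence_bounds[OF assms(2,7), folded assms(5)]
  have s: "s = int (\<Sum>i=1..\<Delta>. d i - 1)"
  proof -
    have "int (\<Sum>i=1..\<Delta>. d i - 1) = (\<Sum>i=1..\<Delta>. int (d i) - 1)"
      unfolding of_nat_sum using d(1) by (intro sum.cong) (auto simp: of_nat_diff)
    then show ?thesis
      by (simp add: assms(8) sum_subtractf)
  qed
  have i: "int ?c \<le> s + 1"
  proof (rule le[OF x0])
    show "int (card (boundary w)) \<le> s" if "w \<in> V - {x0}" for w
      unfolding s assms(5)
      using card_boundary_le_degree_sequence[OF assms(2,7)] that by (intro of_nat_mono) blast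
  qed (unfold s, rule of_nat_0_le_iff)
  have i': "s + 1 \<le> (int \<Delta>)\<^sup>2 - int \<Delta> + 1"
  proof -
    have "(\<Sum>i=1..\<Delta>. int (d i)) \<le> (\<Sum>i=1..\<Delta>. int \<Delta>)"
      using d(2) by (intro sum_mono) auto
    then show ?thesis
      by (simp add: assms(8) power2_eq_square)
  qed
  have ii: "?c \<le> m"
  proof -
    obtain x where "deg x = \<Delta>"
      using max_degree_vertex[OF assms(2)] assms(5) by metis
    then have "nbh x \<noteq> {}"
      using assms(6) by (auto simp: vertex_degree_def)
    then have "E \<noteq> {}"
      using edge_iff_nbh by blast
    then have less: "card (boundary w) < m" for w
      using card_boundary_less_edges assms(4) by blast
    then have "card (boundary w) \<le> m - 1" for w
      by (metis Suc_leI diff_Suc_1 diff_le_mono)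
    \<comment> \<open>There is an edge, so \<open>m\<close> is positive and \<open>m - 1 + 1\<close>
      is \<open>m\<close>.\<close>
    then have "?c \<le> m - 1 + 1"
      by (intro choice_number_le_boundary[OF x0])
    then show ?thesis
      using less[of x0] by linarith
  qed
  have deg_le: "deg w \<le> \<Delta>" if "w \<in> V" for w
    using deg_le_max_degree[OF that] assms(5) by simp
  have boundary_le: "int (card (boundary w))
      \<le> int (deg w) * (int \<Delta> - 2) + int (card {u \<in> nbh w. deg u = \<Delta>})" for w
  proof -
    have "card (boundary w) \<le> deg w * (\<Delta> - 2) + card {u \<in> nbh w. deg u = \<Delta>}"
      using card_boundary_le_count_max_degree[of w] assms(5,6) by simp
    then have "int (card (boundary w)) \<le> int (deg w * (\<Delta> - 2) + card {u \<in> nbh w. deg u = \<Delta>})"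
      by (rule of_nat_mono)
    then show ?thesis
      using assms(6) by (simp add: of_nat_diff)
  qed
  have iii: "int ?c \<le> (int \<Delta>)\<^sup>2 - 2 * int \<Delta> + int t + 1"
    if t: "card {v \<in> V. deg v = \<Delta>} = t" for t
  proof (rule le[OF x0])
    fix w assume "w \<in> V - {x0}"
    then have "int (deg w) * (int \<Delta> - 2) \<le> int \<Delta> * (int \<Delta> - 2)"
      using deg_le assms(6) by (intro mult_right_mono) auto
    moreover have "card {u \<in> nbh w. deg u = \<Delta>} \<le> t"
      unfolding t[symmetric] using finite_V nbh_subset by (intro card_mono) auto
    ultimately show "int (card (boundary w)) \<le> (int \<Delta>)\<^sup>2 - 2 * int \<Delta> + int t"
      using boundary_le[of w] by (simp add: power2_eq_square algebra_simps)
  next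
    have "0 \<le> int \<Delta> * (int \<Delta> - 2)"
      using assms(6) by simp
    then show "0 \<le> (int \<Delta>)\<^sup>2 - 2 * int \<Delta> + int t"
      by (simp add: power2_eq_square algebra_simps)
  qed
  have iv: "int ?c \<le> (int \<Delta>)\<^sup>2 - 3 * int \<Delta> + 4" if unique: "\<exists>!v. v \<in> V \<and> deg v = \<Delta>"
  proof -
    obtain v0 where v0: "v0 \<in> V" "\<And>v. v \<in> V \<Longrightarrow> deg v = \<Delta> \<Longrightarrow> v = v0"
      using unique by blast
    have "int ?c \<le> ((int \<Delta>)\<^sup>2 - 3 * int \<Delta> + 3) + 1"
    \<comment> \<open>The vertex of maximum degree goes first. Every other \<open>w\<close> has
      degree at most \<open>\<Delta> - 1\<close> and at most one neighbor of degree \<Delta>, so its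
      boundary has at most (\<Delta> - 1)(\<Delta> - 2) + 1 elements.\<close>
    proof (rule le[OF v0(1)])
      fix w assume w: "w \<in> V - {v0}"
      have "deg w \<le> \<Delta> - 1"
        using deg_le[of w] v0(2)[of w] w by fastforce
      then have *: "int (deg w) \<le> int \<Delta> - 1"
        using assms(6) by linarith
      have "int (deg w) * (int \<Delta> - 2) \<le> (int \<Delta> - 1) * (int \<Delta> - 2)"
        using * assms(6) by (intro mult_right_mono) auto
      moreover have "card {u \<in> nbh w. deg u = \<Delta>} \<le> card {v0}"
        using v0(2) nbh_subset by (intro card_mono) auto
      ultimately show "int (card (boundary w)) \<le> (int \<Delta>)\<^sup>2 - 3 * int \<Delta> + 3"
        using boundary_le[of w] by (simp add: power2_eq_square algebra_simps)
    next
      have "0 \<le> (int \<Delta> - 1) * (int \<Delta> - 2)"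
        using assms(6) by simp
      then show "0 \<le> (int \<Delta>)\<^sup>2 - 3 * int \<Delta> + 3"
        by (simp add: power2_eq_square algebra_simps)
    qed
    then show ?thesis
      by simp
  qed
  have v: "int ?c \<le> int k * (int k - int l - 1) + 1" if "strongly_regular V E n k l \<mu>" for k l \<mu>
    \<comment> \<open>The bound is nonnegative because it equals the size of the boundary of
      \<open>x0\<close>.\<close>
    using card_boundary_strongly_regular[OF that] x0
    by (intro le[OF x0]) (auto, metis of_nat_0_le_iff)
  have vi: "real ?c \<le> ((real n - 1) / 2)\<^sup>2 + 1"
  proof -
    have "?c \<le> (n - 1)\<^sup>2 div 4 + 1"
      using four_mult_card_boundary_le assms(3)
      by (intro choice_number_le_boundary[OF x0]) (simp add: less_eq_div_iff_mult_less_eq mult.commute)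
    moreover have "real ((n - 1)\<^sup>2 div 4) \<le> real ((n - 1)\<^sup>2) / 4"
      using of_nat_div_le_of_nat[of "(n - 1)\<^sup>2" 4, where ?'a = real] by simp
    moreover have "real ((n - 1)\<^sup>2) / 4 = ((real n - 1) / 2)\<^sup>2"
      using x0 finite_V assms(3) card_gt_0_iff[of V]
      by (auto simp: of_nat_diff power_divide)
    ultimately show ?thesis
      by linarith
  qed
  \<comment> \<open>Chaining the two inequalities of (i) gives the second argument of the minimum in
    (iii).\<close>
  show ?thesis
    by (intro conjI allI impI min.boundedI i i' ii iii iv v vi order_trans[OF i i']) assumption+
qed

end
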